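(* Let $\mathcal{P}\subset\mathbb{R}^2$ be a point cloud, $p\ge1$ an integer, and $\mathbf{x}=[x_1,\dots,x_{n+p+1}]$ a $(p+1)$-regular knot vector with boundary knots $x_{p+1}=a$ and $x_{n+1}=b$. Let $w_t:\mathbb{R}\to[0,+\infty)$, $t\in\mathbb{R}$, be a family of weight functions and let $f_w$ be the weighted quasi interpolant spline approximation of degree $p$ to $\mathcal{P}$ over $\mathbf{x}$. If $\mathcal{P}$ is $w$-increasing (respectively $w$-decreasing), then $f_w$ is increasing (respectively decreasing) on $[a,b]$.
   Context: A point cloud is a finite nonempty set of points. "Increasing" and "decreasing" are meant in the weak sense (non-strict inequalities). B-splines. For a non-decreasing local knot vector $\mathbf{t}=[t_1,\dots,t_{p+2}]$, the B-spline $B[\mathbf{t}]:\mathbb{R}\to\mathbb{R}$ of degree $p$ is defined recursively by $$B[\mathbf{t}](x)=\frac{x-t_1}{t_{p+1}-t_1}B[t_1,\dots,t_{p+1}](x)+\frac{t_{p+2}-x}{t_{p+2}-t_2}B[t_2,\dots,t_{p+2}](x),$$ with $B[t_i,t_{i+1}](x)=1$ if $x\in[t_i,t_{i+1})$ and $0$ otherwise; terms with zero denominator are taken to be $0$ (convention $0/0=0$). For a global non-decreasing knot vector $\mathbf{x}=[x_1,\dots,x_{n+p+1}]$ put $\mathbf{x}^{(i)}=[x_i,\dots,x_{i+p+1}]$, $i=1,\dots,n$. At the right end point $x_{n+1}$ of $[x_{p+1},x_{n+1}]$, the B-splines are evaluated as limits from the left. A knot vector $\mathbf{x}=[x_1,\dots,x_{n+p+1}]$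 is $(p+1)$-regular if $n\ge p+1$, $x_1=x_{p+1}$, $x_{n+1}=x_{n+p+1}$, and $x_j<x_{j+p+1}$ for $j=1,\dots,n$. Weighted quasi interpolant spline approximation (wQISA) of degree $p$ to $\mathcal{P}$ over $\mathbf{x}$: $$f_w(x)=\sum_{i=1}^n\hat y_w(\xi^{(i)})\,B[\mathbf{x}^{(i)}](x),$$ where $\xi^{(i)}=(x_{i+1}+\dots+x_{i+p})/p$ are the knot averages and $$\hat y_w(t)=\frac{\sum_{(x,y)\in\mathcal{P}}y\,w_t(x)}{\sum_{(x,y)\in\mathcal{P}}w_t(x)},\qquad t\in\mathbb{R}.$$ It is assumed that the denominator is positive for every $t\in\mathbb{R}$, so that $\hat y_w:\mathbb{R}\to\mathbb{R}$ is well defined. $w$-monotonicity: $\mathcal{P}$ is $w$-increasing if $\hat y_w(x_1)\le\hat y_w(x_2)$ for all real $x_1\le x_2$, and $w$-decreasing if $\hat y_w(x_1)\ge\hat y_w(x_2)$ for all real $x_1\le x_2$. *)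

theory Defs
  imports "HOL-Analysis.Analysis"
begin

(* A local knot vector [t_1, ..., t_{p+2}] is a list; the degree p is its length minus 2.
   Since z / 0 = 0, summands with zero denominator vanish. Lists with fewer than two
   entries are not knot vectors; the value 0 on them is arbitrary. *)
fun bspline :: "real list \<Rightarrow> real \<Rightarrow> real" where
  "bspline [] x = 0"
| "bspline [t] x = 0"
| "bspline [t, s] x = (if x \<in> {t..<s} then 1 else 0)"
| "bspline (t # s # r # ts) x =
     (x - t) / (last (butlast (t # s # r # ts)) - t) * bspline (butlast (t # s # r # ts)) x
   + (last (r # ts) - x) / (last (r # ts) - s) * bspline (s # r # ts) x"

(* A global knot vector [x_1, ..., x_{n+p+1}] is a function on nat, of which only the
   values at the indices 1, ..., n+p+1 matter. *)
definition knot_vector :: "nat \<Rightarrow> nat \<Rightarrow> (nat \<Rightarrow> real) \<Rightarrow> bool" where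
  "knot_vector p n x \<longleftrightarrow> mono_on {1..n + p + 1} x"

(* This is (p+1)-regularity. *)
definition regular_knot_vector :: "nat \<Rightarrow> nat \<Rightarrow> (nat \<Rightarrow> real) \<Rightarrow> bool" where
  "regular_knot_vector p n x \<longleftrightarrow>
     knot_vector p n x \<and> n \<ge> p + 1 \<and> x 1 = x (p + 1) \<and> x (n + 1) = x (n + p + 1) \<and>
     (\<forall>j\<in>{1..n}. x j < x (j + p + 1))"

definition local_knots :: "nat \<Rightarrow> (nat \<Rightarrow> real) \<Rightarrow> nat \<Rightarrow> real list" where
  "local_knots p x i = map x [i..<i + p + 2]"

(* At the right end point x_{n+1} the B-splines are evaluated as limits from the left. *)
definition bspline_basis :: "nat \<Rightarrow> nat \<Rightarrow> (nat \<Rightarrow> real) \<Rightarrow> nat \<Rightarrow> real \<Rightarrow> real" where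
  "bspline_basis p n x i u =
     (if u = x (n + 1) then Lim (at_left u) (bspline (local_knots p x i))
      else bspline (local_knots p x i) u)"

definition knot_average :: "nat \<Rightarrow> (nat \<Rightarrow> real) \<Rightarrow> nat \<Rightarrow> real" where
  "knot_average p x i = (\<Sum>j = i + 1..i + p. x j) / real p"

definition point_cloud :: "(real \<times> real) set \<Rightarrow> bool" where
  "point_cloud P \<longleftrightarrow> finite P \<and> P \<noteq> {}"

(* The weight functions are w t for real t. *)
definition weighted_average ::
  "(real \<times> real) set \<Rightarrow> (real \<Rightarrow> real \<Rightarrow> real) \<Rightarrow> real \<Rightarrow> real" where
  "weighted_average P w t = (\<Sum>(x, y)\<in>P. y * w t x) / (\<Sum>(x, y)\<in>P. w t x)"

definition wQISA ::
  "(real \<times> real) set \<Rightarrow> (real \<Rightarrow> real \<Rightarrow> real) \<Rightarrow> nat \<Rightarrow> nat \<Rightarrow> (nat \<Rightarrow> real) \<Rightarrow> real \<Rightarrow> real" where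
  "wQISA P w p n x u =
     (\<Sum>i = 1..n. weighted_average P w (knot_average p x i) * bspline_basis p n x i u)"

definition w_increasing :: "(real \<times> real) set \<Rightarrow> (real \<Rightarrow> real \<Rightarrow> real) \<Rightarrow> bool" where
  "w_increasing P w \<longleftrightarrow> mono (weighted_average P w)"

definition w_decreasing :: "(real \<times> real) set \<Rightarrow> (real \<Rightarrow> real \<Rightarrow> real) \<Rightarrow> bool" where
  "w_decreasing P w \<longleftrightarrow> antimono (weighted_average P w)"

end

theory Submission
  imports Defs
begin

text \<open>
  Write \<open>B\<^sub>i\<^sub>,\<^sub>q\<close> for the B-spline of degree \<open>q\<close> whose first knot is \<open>x\<^sub>i\<close>, and consider the tail sums
  \<open>S\<^sub>j\<^sub>,\<^sub>q = B\<^sub>j\<^sub>,\<^sub>q + \<dots> + B\<^sub>n\<^sub>,\<^sub>q\<close>. Everything rests on the fact that each tail sum is an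
  increasing function on the left of \<open>x\<^sub>n\<^sub>+\<^sub>1\<close> (lemma \<open>tail_sum_mono\<close>). This can be shown without
  derivatives, hence with no regard to the multiplicity of the knots: summing the recursion
  of the B-splines, neighbouring terms telescope (\<open>tail_sum_rec\<close>) and leave
  \<open>S\<^sub>j\<^sub>,\<^sub>q\<^sub>+\<^sub>1 = (1 - \<omega>) S\<^sub>j\<^sub>+\<^sub>1\<^sub>,\<^sub>q + \<omega> S\<^sub>j\<^sub>,\<^sub>q\<close> with
  \<open>\<omega> (u) = (u - x\<^sub>j) / (x\<^sub>j\<^sub>+\<^sub>q\<^sub>+\<^sub>1 - x\<^sub>j)\<close>. Since \<open>S\<^sub>j\<^sub>,\<^sub>q\<close> and \<open>S\<^sub>j\<^sub>+\<^sub>1\<^sub>,\<^sub>q\<close> differ only on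
  \<open>[x\<^sub>j, x\<^sub>j\<^sub>+\<^sub>q\<^sub>+\<^sub>1)\<close>, the weight \<open>\<omega>\<close> may be clamped to \<open>[0,1]\<close>; so \<open>S\<^sub>j\<^sub>,\<^sub>q\<^sub>+\<^sub>1\<close> is a convex combination
  of two increasing functions whose weight moves, as \<open>u\<close> grows, towards the larger of them.

  The same recursion gives \<open>S\<^sub>1\<^sub>,\<^sub>p = 1\<close> on \<open>[a, b)\<close> (\<open>tail_sum_eq_1\<close>). Summation by parts then
  shows that every spline with increasing coefficients increases on \<open>[a, b)\<close>
  (\<open>spline_mono_interior\<close>), and the value at \<open>b\<close>, being a limit from the left, continues the
  monotonicity. It applies to \<open>f\<^sub>w\<close> because the knot averages, and with them the values of the
  monotone function \<open>t \<mapsto> y\<^sub>w (t)\<close> at them, are ordered; the decreasing case is the increasing one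
  with the coefficients negated.
\<close>

section \<open>B-splines over a global knot vector\<close>

lemma bspline_local_knots_0:
  "bspline (local_knots 0 x i) u = (if x i \<le> u \<and> u < x (Suc i) then 1 else 0)"
  by (simp add: local_knots_def upt_rec)

lemma bspline_local_knots_Suc:
  "bspline (local_knots (Suc q) x i) u =
     (u - x i) / (x (i + q + 1) - x i) * bspline (local_knots q x i) u
   + (x (i + q + 2) - u) / (x (i + q + 2) - x (i + 1)) * bspline (local_knots q x (Suc i)) u"
proof -
  have front: "local_knots (Suc q) x i = x i # x (Suc i) # x (Suc (Suc i)) # map x [i+3..<i+q+3]"
    by (simp add: local_knots_def upt_conv_Cons numeral_eq_Suc del: upt_Suc)
  have b: "butlast (local_knots (Suc q) x i) = local_knots q x i"
    by (simp add: local_knots_def butlast_append)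
  have l: "last (local_knots q x i) = x (i + q + 1)"
    by (simp add: local_knots_def)
  have tl: "local_knots q x (Suc i) = x (Suc i) # x (Suc (Suc i)) # map x [i+3..<i+q+3]"
    by (simp add: local_knots_def upt_conv_Cons numeral_eq_Suc del: upt_Suc)
  have "last (local_knots q x (Suc i)) = x (i + q + 2)"
    by (simp add: local_knots_def)
  then have l': "last (x (Suc (Suc i)) # map x [i+3..<i+q+3]) = x (i + q + 2)"
    unfolding tl by simp
  show ?thesis
    using b l l' tl unfolding front by simp
qed

lemma bspline_support:
  assumes "mono_on {i..i + q + 1} x" and "u < x i \<or> x (i + q + 1) \<le> u"
  shows "bspline (local_knots q x i) u = 0"
  using assms
proof (induction q arbitrary: i)
  case 0
  then show ?case by (auto simp: bspline_local_knots_0)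
next
  case (Suc q)
  have le: "x i \<le> x (Suc i)" "x (i + q + 1) \<le> x (i + q + 2)"
    by (rule mono_onD[OF Suc.prems(1)]; simp)+
  have "bspline (local_knots q x i) u = 0"
    by (rule Suc.IH) (use Suc.prems le in \<open>auto intro: mono_on_subset\<close>)
  moreover have "bspline (local_knots q x (Suc i)) u = 0"
    by (rule Suc.IH) (use Suc.prems le in \<open>auto intro: mono_on_subset\<close>)
  ultimately show ?case by (simp add: bspline_local_knots_Suc)
qed

lemma bspline_nonneg:
  assumes "mono_on {i..i + q + 1} x"
  shows "bspline (local_knots q x i) u \<ge> 0"
  using assms
proof (induction q arbitrary: i)
  case 0
  then show ?case by (simp add: bspline_local_knots_0)
next
  case (Suc q)
  have m: "mono_on {i..i + q + 1} x" "mono_on {Suc i..Suc i + q + 1} x"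
    using Suc.prems by (auto intro: mono_on_subset)
  have le: "x i \<le> x (i + q + 1)" "x (i + 1) \<le> x (i + q + 2)"
    by (rule mono_onD[OF Suc.prems]; simp)+
  have "(u - x i) / (x (i + q + 1) - x i) * bspline (local_knots q x i) u \<ge> 0"
  proof (cases "u < x i")
    case True
    then show ?thesis using bspline_support[OF m(1)] by simp
  next
    case False
    then show ?thesis
      using le(1) Suc.IH[OF m(1)] by (intro mult_nonneg_nonneg divide_nonneg_nonneg) auto
  qed
  moreover have "(x (i + q + 2) - u) / (x (i + q + 2) - x (i + 1))
      * bspline (local_knots q x (Suc i)) u \<ge> 0"
  proof (cases "x (i + q + 2) \<le> u")
    case True
    then show ?thesis using bspline_support[OF m(2)] by simp
  next
    case False
    then show ?thesis
      using le(2) Suc.IH[OF m(2)] by (intro mult_nonneg_nonneg divide_nonneg_nonneg) auto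
  qed
  ultimately show ?case by (simp add: bspline_local_knots_Suc)
qed

text \<open>
  Existence of the limit is what makes the value given to the B-splines at the right end point,
  defined by \<^const>\<open>Lim\<close>, an actual limit.
\<close>
lemma bspline_left_limit:
  "\<exists>l. (bspline (local_knots q x i) \<longlongrightarrow> l) (at_left b)"
proof (induction q arbitrary: i)
  case 0
  show ?case
  proof (cases "x i < b \<and> b \<le> x (Suc i)")
    case True
    then have "\<forall>\<^sub>F u in at_left b. bspline (local_knots 0 x i) u = 1"
      by (intro eventually_at_leftI[of "x i"]) (auto simp: bspline_local_knots_0)
    then show ?thesis by (blast intro: tendsto_eventually)
  next
    case False
    have "\<forall>\<^sub>F u in at_left b. bspline (local_knots 0 x i) u = 0"
    proof (cases "b \<le> x i")
      case True
      then show ?thesis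
        by (intro eventually_at_leftI[of "b - 1"]) (auto simp: bspline_local_knots_0)
    next
      case 2: False
      with False have "x (Suc i) < b" by simp
      then show ?thesis
        by (intro eventually_at_leftI[of "x (Suc i)"]) (auto simp: bspline_local_knots_0)
    qed
    then show ?thesis by (blast intro: tendsto_eventually)
  qed
next
  case (Suc q)
  obtain l m where "(bspline (local_knots q x i) \<longlongrightarrow> l) (at_left b)"
    "(bspline (local_knots q x (Suc i)) \<longlongrightarrow> m) (at_left b)"
    using Suc.IH by blast
  then have "((\<lambda>u. (u - x i) / (x (i + q + 1) - x i) * bspline (local_knots q x i) u
      + (x (i + q + 2) - u) / (x (i + q + 2) - x (i + 1)) * bspline (local_knots q x (Suc i)) u)
      \<longlongrightarrow> (b - x i) / (x (i + q + 1) - x i) * l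
      + (x (i + q + 2) - b) / (x (i + q + 2) - x (i + 1)) * m) (at_left b)"
    unfolding divide_inverse by (intro tendsto_intros)
  then show ?case
    unfolding bspline_local_knots_Suc[abs_def] by blast
qed

section \<open>Tail sums of B-splines\<close>

text \<open>
  The upper summation bound is \<open>n\<close> for all degrees: on the left of \<open>x\<^sub>n\<^sub>+\<^sub>1\<close> the further B-splines of lower
  degree vanish, so that the recursion in the degree closes up with \<open>n\<close> fixed.
\<close>
definition tail_sum :: "nat \<Rightarrow> (nat \<Rightarrow> real) \<Rightarrow> nat \<Rightarrow> nat \<Rightarrow> real \<Rightarrow> real" where
  "tail_sum n x q j u = (\<Sum>i = j..n. bspline (local_knots q x i) u)"

lemma tail_sum_first:
  "j \<le> n \<Longrightarrow> tail_sum n x q j u = bspline (local_knots q x j) u + tail_sum n x q (Suc j) u"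
  by (simp add: tail_sum_def sum.atLeast_Suc_atMost)

lemma tail_sum_0:
  assumes "mono_on {1..n + 1} x" "1 \<le> j" "j \<le> n + 1" "u < x (n + 1)"
  shows "tail_sum n x 0 j u = (if x j \<le> u then 1 else 0)"
  using \<open>j \<le> n + 1\<close> \<open>1 \<le> j\<close>
proof (induction rule: inc_induct)
  case base
  then show ?case using assms(4) by (simp add: tail_sum_def)
next
  case (step j)
  have "x j \<le> x (Suc j)"
    by (rule mono_onD[OF assms(1)]) (use step in auto)
  then show ?case
    using step by (auto simp: tail_sum_first bspline_local_knots_0)
qed

text \<open>
  In the sum of the recursions, \<open>B\<^sub>i\<^sub>,\<^sub>q\<close> occurs once from each of two neighbours, with weights
  adding up to 1, except for the first one, \<open>B\<^sub>j\<^sub>,\<^sub>q\<close>, and for \<open>B\<^sub>n\<^sub>+\<^sub>1\<^sub>,\<^sub>q\<close>, which vanishes at \<open>u\<close>.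
\<close>
lemma tail_sum_rec:
  assumes x: "mono_on {1..n + q + 2} x" and "1 \<le> j" "j \<le> n + 1" and u: "u < x (n + 1)"
  shows "tail_sum n x (Suc q) j u =
    tail_sum n x q (Suc j) u + (u - x j) / (x (j + q + 1) - x j) * bspline (local_knots q x j) u"
  using \<open>j \<le> n + 1\<close> \<open>1 \<le> j\<close>
proof (induction rule: inc_induct)
  case base
  have "mono_on {n + 1..n + 1 + q + 1} x"
    by (rule mono_on_subset[OF x]) auto
  from bspline_support[OF this] u show ?case
    by (simp add: tail_sum_def)
next
  case (step j)
  define B where "B = bspline (local_knots q x (Suc j)) u"
  define d where "d = x (j + q + 2) - x (j + 1)"
  have m: "mono_on {Suc j..Suc j + q + 1} x"
    by (rule mono_on_subset[OF x]) (use step in auto)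
  (* For d = 0 both weights have the value 0, but then the support of B is empty. *)
  have "(x (j + q + 2) - u) / d * B + (u - x (j + 1)) / d * B = B"
  proof (cases "d = 0")
    case True
    then have "B = 0"
      unfolding B_def by (intro bspline_support[OF m]) (auto simp: d_def)
    then show ?thesis by simp
  next
    case False
    have "(x (j + q + 2) - u) / d * B + (u - x (j + 1)) / d * B = d / d * B"
      unfolding distrib_right[symmetric] add_divide_distrib[symmetric] by (simp add: d_def)
    with False show ?thesis by simp
  qed
  moreover have "tail_sum n x (Suc q) j u =
      (u - x j) / (x (j + q + 1) - x j) * bspline (local_knots q x j) u
      + (x (j + q + 2) - u) / d * B + tail_sum n x (Suc q) (Suc j) u"
    using step.hyps by (simp add: tail_sum_first bspline_local_knots_Suc B_def d_def)
  moreover have "tail_sum n x (Suc q) (Suc j) u =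
      tail_sum n x q (Suc (Suc j)) u + (u - x (j + 1)) / d * B"
    using step.IH by (simp add: B_def d_def)
  moreover have "tail_sum n x q (Suc j) u = B + tail_sum n x q (Suc (Suc j)) u"
  proof (cases "Suc j \<le> n")
    case True
    then show ?thesis by (simp add: tail_sum_first B_def)
  next
    case False
    with step.hyps have "Suc j = n + 1" by simp
    then have "B = 0"
      unfolding B_def by (intro bspline_support[OF m]) (use u in auto)
    with False show ?thesis by (simp add: tail_sum_def)
  qed
  ultimately show ?case by simp
qed

text \<open>
  In degree 0 the tail sum is the step function that jumps from 0 to 1 at \<open>x\<^sub>j\<close>. When the degree is
  raised, moving from \<open>u\<close> to \<open>v\<close> first increases the two functions in the convex combination with the
  weight held at \<open>\<omega> (u)\<close>, and then shifts weight to the larger one; the gap between the two is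
  \<open>B\<^sub>j\<^sub>,\<^sub>q \<ge> 0\<close>.
\<close>
lemma tail_sum_mono:
  assumes "mono_on {1..n + q + 1} x" "1 \<le> j" "j \<le> n + 1" "u \<le> v" "v < x (n + 1)"
  shows "tail_sum n x q j u \<le> tail_sum n x q j v"
  using assms(1-3)
proof (induction q arbitrary: j)
  case 0
  then show ?case
    using \<open>u \<le> v\<close> \<open>v < x (n + 1)\<close> by (simp add: tail_sum_0)
next
  case (Suc q)
  have x: "mono_on {1..n + q + 2} x" using Suc.prems(1) by simp
  have IH: "tail_sum n x q i u \<le> tail_sum n x q i v" if "1 \<le> i" "i \<le> n + 1" for i
    by (rule Suc.IH) (use that in \<open>auto intro: mono_on_subset[OF x]\<close>)
  define w where "w t = max 0 (min 1 ((t - x j) / (x (j + q + 1) - x j)))" for t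
  define B where "B = bspline (local_knots q x j)"
  have m: "mono_on {j..j + q + 1} x"
    by (rule mono_on_subset[OF x]) (use Suc.prems in auto)
  have knots: "x j \<le> x (j + q + 1)"
    by (rule mono_onD[OF m]) auto
  have rec: "tail_sum n x (Suc q) j t = tail_sum n x q (Suc j) t + w t * B t"
    if "t < x (n + 1)" for t
  proof -
    have "(t - x j) / (x (j + q + 1) - x j) * B t = w t * B t"
    proof (cases "x j \<le> t \<and> t < x (j + q + 1)")
      case True
      then have "0 \<le> (t - x j) / (x (j + q + 1) - x j)" "(t - x j) / (x (j + q + 1) - x j) \<le> 1"
        by (auto simp: divide_simps)
      then show ?thesis by (simp add: w_def)
    next
      case False
      then have "B t = 0" unfolding B_def by (intro bspline_support[OF m]) auto
      then show ?thesis by simp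
    qed
    then show ?thesis
      using tail_sum_rec[OF x _ _ that, of j] Suc.prems by (simp add: B_def)
  qed
  have w01: "0 \<le> w u" "w u \<le> 1" by (auto simp: w_def)
  have "(u - x j) / (x (j + q + 1) - x j) \<le> (v - x j) / (x (j + q + 1) - x j)"
    using \<open>u \<le> v\<close> knots by (intro divide_right_mono) auto
  then have w: "w u \<le> w v" unfolding w_def by linarith
  have B_eq: "B t = tail_sum n x q j t - tail_sum n x q (Suc j) t" if "t < x (n + 1)" for t
  proof (cases "j \<le> n")
    case True
    then show ?thesis by (simp add: tail_sum_first B_def)
  next
    case False
    with Suc.prems have "j = n + 1" by simp
    then have "B t = 0" unfolding B_def by (intro bspline_support[OF m]) (use that in auto)
    with False show ?thesis by (simp add: tail_sum_def)
  qed
  have IH': "tail_sum n x q (Suc j) u \<le> tail_sum n x q (Suc j) v"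
  proof (cases "j \<le> n")
    case True
    then show ?thesis by (intro IH) auto
  qed (simp add: tail_sum_def)
  have u: "u < x (n + 1)" using \<open>u \<le> v\<close> \<open>v < x (n + 1)\<close> by simp
  have "tail_sum n x (Suc q) j u
      = (1 - w u) * tail_sum n x q (Suc j) u + w u * tail_sum n x q j u"
    unfolding rec[OF u] B_eq[OF u] by (simp add: algebra_simps)
  also have "\<dots> \<le> (1 - w u) * tail_sum n x q (Suc j) v + w u * tail_sum n x q j v"
    using w01 IH' IH[of j] Suc.prems by (intro add_mono mult_left_mono) auto
  also have "\<dots> = tail_sum n x q (Suc j) v + w u * B v"
    unfolding B_eq[OF \<open>v < x (n + 1)\<close>] by (simp add: algebra_simps)
  also have "\<dots> \<le> tail_sum n x q (Suc j) v + w v * B v"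
    using w bspline_nonneg[OF m] by (intro add_left_mono mult_right_mono) (auto simp: B_def)
  also have "\<dots> = tail_sum n x (Suc q) j v"
    using rec[OF \<open>v < x (n + 1)\<close>] by simp
  finally show ?case .
qed

text \<open>
  Partition of unity. The recursion moves the first index down by one as the degree grows by one;
  the B-splines that enter have last knot \<open>x\<^sub>p\<^sub>+\<^sub>1\<close> and so vanish at \<open>u\<close>.
\<close>
lemma tail_sum_eq_1:
  assumes x: "mono_on {1..n + p + 1} x" and "p \<le> n" and u: "x (p + 1) \<le> u" "u < x (n + 1)"
  shows "tail_sum n x p 1 u = 1"
proof -
  have "tail_sum n x q (p + 1 - q) u = 1" if "q \<le> p" for q
    using that
  proof (induction q)
    case 0
    have "mono_on {1..n + 1} x" by (rule mono_on_subset[OF x]) auto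
    then show ?case using \<open>p \<le> n\<close> u by (subst tail_sum_0) auto
  next
    case (Suc q)
    define j where "j = p - q"
    have j: "1 \<le> j" "j \<le> n" "j + q = p" using Suc.prems \<open>p \<le> n\<close> by (auto simp: j_def)
    have "mono_on {1..n + q + 2} x"
      by (rule mono_on_subset[OF x]) (use Suc.prems in auto)
    moreover have "mono_on {j..j + q + 1} x"
      by (rule mono_on_subset[OF x]) (use j \<open>p \<le> n\<close> in auto)
    then have "bspline (local_knots q x j) u = 0"
      by (rule bspline_support) (use j u in auto)
    ultimately have "tail_sum n x (Suc q) j u = tail_sum n x q (Suc j) u"
      using tail_sum_rec[of n q x j u] j u by simp
    also have "\<dots> = 1"
      using Suc by (simp add: j_def Suc_diff_le)
    finally show ?case by (simp add: j_def)
  qed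
  from this[of p] show ?thesis by simp
qed

section \<open>Splines with monotone coefficients\<close>

text \<open>
  Summation by parts as an induction: the tail beyond \<open>k\<close> is nonnegative, so in front of it the
  coefficient \<open>c (k + 1)\<close> may be lowered to \<open>c k\<close>.
\<close>
lemma Abel_sum_lower_bound:
  fixes c d :: "nat \<Rightarrow> real"
  assumes "mono_on {k..n} c" "k \<le> n"
    and "\<And>j. k \<le> j \<Longrightarrow> j \<le> n \<Longrightarrow> 0 \<le> (\<Sum>i = j..n. d i)"
  shows "c k * (\<Sum>i = k..n. d i) \<le> (\<Sum>i = k..n. c i * d i)"
  using \<open>k \<le> n\<close> assms(1,3)
proof (induction rule: inc_induct)
  case base
  then show ?case by simp
next
  case (step k)
  have "c k \<le> c (Suc k)" by (rule mono_onD[OF step.prems(1)]) (use step.hyps in auto)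
  then have "c k * (\<Sum>i = Suc k..n. d i) \<le> c (Suc k) * (\<Sum>i = Suc k..n. d i)"
    using step by (intro mult_right_mono) auto
  also have "\<dots> \<le> (\<Sum>i = Suc k..n. c i * d i)"
    by (rule step.IH) (use step.prems in \<open>auto intro: mono_on_subset\<close>)
  finally show ?case
    using step.hyps by (simp add: sum.atLeast_Suc_atMost distrib_left)
qed

text \<open>
  Apply the previous bound to the increments \<open>d\<close> of the B-splines: their tails are nonnegative, and
  the partition of unity makes their total 0, whatever the sign of \<open>c 1\<close>.
\<close>
lemma spline_mono_interior:
  assumes x: "mono_on {1..n + p + 1} x" and "p < n" and c: "mono_on {1..n} c"
    and uv: "x (p + 1) \<le> u" "u \<le> v" "v < x (n + 1)"
  shows "(\<Sum>i = 1..n. c i * bspline (local_knots p x i) u)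
       \<le> (\<Sum>i = 1..n. c i * bspline (local_knots p x i) v)"
proof -
  define d where "d i = bspline (local_knots p x i) v - bspline (local_knots p x i) u" for i
  have tail: "(\<Sum>i = j..n. d i) = tail_sum n x p j v - tail_sum n x p j u" for j
    by (simp add: d_def tail_sum_def sum_subtractf)
  have "(\<Sum>i = 1..n. d i) = 0"
    using tail_sum_eq_1[OF x, of u] tail_sum_eq_1[OF x, of v] uv \<open>p < n\<close>
    by (simp add: tail del: One_nat_def)
  moreover have "c 1 * (\<Sum>i = 1..n. d i) \<le> (\<Sum>i = 1..n. c i * d i)"
    by (rule Abel_sum_lower_bound[OF c]) (use tail_sum_mono[OF x] uv \<open>p < n\<close> in \<open>auto simp: tail\<close>)
  ultimately have "0 \<le> (\<Sum>i = 1..n. c i * d i)" by (simp del: One_nat_def)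
  then show ?thesis by (simp add: d_def right_diff_distrib sum_subtractf)
qed

lemma spline_mono:
  assumes reg: "regular_knot_vector p n x" and c: "mono_on {1..n} c"
  shows "mono_on {x (p + 1)..x (n + 1)} (\<lambda>u. \<Sum>i = 1..n. c i * bspline_basis p n x i u)"
proof (rule mono_onI)
  fix u v assume "u \<in> {x (p + 1)..x (n + 1)}" "v \<in> {x (p + 1)..x (n + 1)}" "u \<le> v"
  then have uv: "x (p + 1) \<le> u" "u \<le> v" "v \<le> x (n + 1)" by auto
  have x: "mono_on {1..n + p + 1} x" and "p < n"
    using reg by (auto simp: regular_knot_vector_def knot_vector_def)
  define b where "b = x (n + 1)"
  define g where "g u = (\<Sum>i = 1..n. c i * bspline (local_knots p x i) u)" for u
  define f where "f u = (\<Sum>i = 1..n. c i * bspline_basis p n x i u)" for u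
  have f_eq_g: "f t = g t" if "t < b" for t
    using that by (simp add: f_def g_def bspline_basis_def b_def)
  have "f u \<le> f v"
  proof (cases "u = v \<or> v < b")
    case True
    then show ?thesis
      using spline_mono_interior[OF x \<open>p < n\<close> c] uv f_eq_g[of u] f_eq_g[of v]
      by (auto simp: g_def b_def)
  next
    case False
    with uv have "v = b" "u < b" by (auto simp: b_def)
    have "(bspline (local_knots p x i) \<longlongrightarrow> bspline_basis p n x i b) (at_left b)" for i
    proof -
      obtain l where "(bspline (local_knots p x i) \<longlongrightarrow> l) (at_left b)"
        using bspline_left_limit by blast
      moreover from tendsto_Lim[OF _ this] have "bspline_basis p n x i b = l"
        by (simp add: bspline_basis_def b_def)
      ultimately show ?thesis by simp
    qed
    then have "(g \<longlongrightarrow> f b) (at_left b)"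
      unfolding g_def f_def by (intro tendsto_intros)
    moreover have "\<forall>\<^sub>F t in at_left b. g u \<le> g t"
    proof (rule eventually_at_leftI[OF _ \<open>u < b\<close>])
      fix t assume "t \<in> {u<..<b}"
      then show "g u \<le> g t"
        unfolding g_def
        by (intro spline_mono_interior[OF x \<open>p < n\<close> c]) (use uv in \<open>auto simp: b_def\<close>)
    qed
    ultimately have "g u \<le> f b"
      by (intro tendsto_lowerbound) auto
    then show ?thesis using f_eq_g \<open>u < b\<close> \<open>v = b\<close> by simp
  qed
  then show "(\<Sum>i = 1..n. c i * bspline_basis p n x i u)
      \<le> (\<Sum>i = 1..n. c i * bspline_basis p n x i v)"
    by (simp add: f_def)
qed

lemma knot_average_mono:
  assumes "mono_on {1..n + p + 1} x"
  shows "mono_on {1..n} (knot_average p x)"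
proof (rule mono_onI)
  fix i k assume ik: "i \<in> {1..n}" "k \<in> {1..n}" "i \<le> k"
  have shift: "(\<Sum>j = l + 1..l + p. x j) = (\<Sum>j = 1..p. x (j + l))" for l
    using sum.shift_bounds_cl_nat_ivl[of x 1 l p] by (simp add: add.commute)
  have "(\<Sum>j = 1..p. x (j + i)) \<le> (\<Sum>j = 1..p. x (j + k))"
    using ik by (intro sum_mono mono_onD[OF assms]) auto
  then show "knot_average p x i \<le> knot_average p x k"
    unfolding knot_average_def shift by (intro divide_right_mono) auto
qed

theorem propositionA4:
  fixes P :: "(real \<times> real) set" and p n :: nat and x :: "nat \<Rightarrow> real"
    and a b :: real and w :: "real \<Rightarrow> real \<Rightarrow> real"
  assumes "point_cloud P"
    and "p \<ge> 1"
    and "regular_knot_vector p n x"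
    and "x (p + 1) = a" and "x (n + 1) = b"
    and "\<And>t u. w t u \<ge> 0"
    and "\<And>t. (\<Sum>(u, v)\<in>P. w t u) > 0"
  shows "(w_increasing P w \<longrightarrow> mono_on {a..b} (wQISA P w p n x)) \<and>
         (w_decreasing P w \<longrightarrow> antimono_on {a..b} (wQISA P w p n x))"
proof (intro conjI impI)
  define c where "c i = weighted_average P w (knot_average p x i)" for i
  have f: "wQISA P w p n x u = (\<Sum>i = 1..n. c i * bspline_basis p n x i u)" for u
    by (simp add: wQISA_def c_def)
  have avg: "mono_on {1..n} (knot_average p x)"
    using assms(3) by (intro knot_average_mono) (simp add: regular_knot_vector_def knot_vector_def)
  {
    assume "w_increasing P w"
    then have "mono_on {1..n} c"
      unfolding c_def w_increasing_def
      by (intro mono_onI, elim monoD) (rule mono_onD[OF avg])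
    from spline_mono[OF assms(3) this] show "mono_on {a..b} (wQISA P w p n x)"
      using assms(4,5) by (simp add: f[abs_def])
  next
    assume "w_decreasing P w"
    then have "mono_on {1..n} (\<lambda>i. - c i)"
      unfolding c_def w_decreasing_def
      by (intro mono_onI le_imp_neg_le, elim antimonoD) (rule mono_onD[OF avg])
    from spline_mono[OF assms(3) this] show "antimono_on {a..b} (wQISA P w p n x)"
      using assms(4,5) by (auto simp: f[abs_def] sum_negf monotone_on_def)
  }
qed

end
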